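(* Let $N\ge 2$ and $l\ge 1$ be integers. Each element $w \in \bar{\mathcal{A}}^l$ has a unique immediate successor in $\bar{\mathcal{A}}^l$ and a unique immediate predecessor in $\bar{\mathcal{A}}^l$.
   Context: $F_N$ is the free monoid of all finite words with letters in $\mathbb{Z}/N\mathbb{Z}$ (identity: the empty word $\varepsilon$); juxtaposition of letters is concatenation. $\pi : F_N \to \mathrm{SL}_2(\mathbb{Z}/N\mathbb{Z})$ is the monoid homomorphism with $\pi(\alpha) = \begin{bmatrix} 0 & 1 \\ -1 & \alpha \end{bmatrix}$ for each letter $\alpha$, so $\pi(\alpha_1\cdots\alpha_l)=\pi(\alpha_1)\cdots\pi(\alpha_l)$ and $\pi(\varepsilon)$ is the identity matrix. On $(\mathbb{Z}/N\mathbb{Z})^2\smallsetminus\{0\}$ (column vectors) let $u\sim' v$ if and only if $u=\lambda v$ for some $\lambda\in(\mathbb{Z}/N\mathbb{Z})^\times$; $\mathrm{SL}_2(\mathbb{Z}/N\mathbb{Z})$ acts on the set of $\sim'$-classes by left multiplication. $\bar{\mathcal{A}} = \left\{w \in F_N : \pi(w)\begin{bmatrix} 0 \\ 1 \end{bmatrix} = \begin{bmatrix} 1 \\ 0 \end{bmatrix} \text{ as } \sim'\text{-classes}\right\}$. $F_N^l$ is the set of words of length $l$ and $\bar{\mathcal{A}}^l=F_N^l\cap\bar{\mathcal{A}}$. Given two words of the form $w = \alpha_0\alpha_1\cdots\alpha_{l-1}$ and $w' = \alpha_1\alpha_2\cdots\alpha_l$ in $F_N$, $w'$ is called an immediate successor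 of $w$ and $w$ an immediate predecessor of $w'$. *)

theory Defs
  imports "HOL-Analysis.Determinants" "Berlekamp_Zassenhaus.Finite_Field"
begin

text \<open>
  The ring of integers modulo \<open>N\<close> is the type \<open>'n mod_ring\<close> with \<open>N = CARD('n)\<close>. The class
  \<open>nontriv\<close> means exactly \<open>CARD('n) > 1\<close>, so a type variable \<open>'n::nontriv\<close> ranges over all
  \<open>N \<ge> 2\<close>, and \<open>N\<close> need not be prime. The free monoid \<open>F_N\<close> on the letters in
  \<open>'n mod_ring\<close> is the type of lists over it, with \<open>@\<close> as product.
\<close>

type_synonym 'n word = "'n mod_ring list"

definition SL2 :: "('n::nontriv mod_ring ^ 2 ^ 2) set" where
  "SL2 = {M. det M = 1}"

definition letter_mat :: "'n::nontriv mod_ring \<Rightarrow> 'n mod_ring ^ 2 ^ 2" where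
  "letter_mat \<alpha> = vector [vector [0, 1], vector [-1, \<alpha>]]"

primrec word_mat :: "'n::nontriv word \<Rightarrow> 'n mod_ring ^ 2 ^ 2" where
  "word_mat [] = mat 1"
| "word_mat (\<alpha> # w) = letter_mat \<alpha> ** word_mat w"

lemma word_mat_append: "word_mat (v @ w) = word_mat v ** word_mat w"
  by (induction v) (simp_all add: matrix_mul_assoc)

lemma letter_mat_in_SL2: "letter_mat \<alpha> \<in> SL2"
  by (simp add: SL2_def letter_mat_def det_2)

lemma word_mat_in_SL2: "word_mat w \<in> SL2"
  by (induction w) (use letter_mat_in_SL2 in \<open>simp_all add: SL2_def det_mul\<close>)

definition nonzero_vecs :: "('n::nontriv mod_ring ^ 2) set" where
  "nonzero_vecs = - {0}"

text \<open>The units of a commutative ring are its divisors of \<open>1\<close>.\<close>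

definition unit_rel :: "(('n::nontriv mod_ring ^ 2) \<times> ('n mod_ring ^ 2)) set" where
  "unit_rel = {(u, v). u \<in> nonzero_vecs \<and> v \<in> nonzero_vecs \<and> (\<exists>c. c dvd 1 \<and> u = c *s v)}"

lemma equiv_unit_rel: "equiv nonzero_vecs (unit_rel :: (('n::nontriv mod_ring ^ 2) \<times> _) set)"
proof (rule equivI)
  show "unit_rel \<subseteq> nonzero_vecs \<times> (nonzero_vecs :: ('n mod_ring ^ 2) set)"
    by (auto simp: unit_rel_def)
  show "refl_on nonzero_vecs (unit_rel :: (('n mod_ring ^ 2) \<times> _) set)"
    by (auto simp: unit_rel_def refl_on_def intro!: exI[of _ 1])
  show "sym (unit_rel :: (('n mod_ring ^ 2) \<times> _) set)"
  proof (rule symI)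
    fix u v :: "'n mod_ring ^ 2"
    assume "(u, v) \<in> unit_rel"
    then obtain c where c: "u \<in> nonzero_vecs" "v \<in> nonzero_vecs" "c dvd 1" "u = c *s v"
      by (auto simp: unit_rel_def)
    from c(3) obtain d where d: "1 = c * d" by (elim dvdE)
    then have "v = d *s u"
      using c(4) by (simp add: vector_smult_assoc mult.commute[of d c] flip: d)
    moreover have "d dvd 1"
      using d by (metis dvd_triv_right)
    ultimately show "(v, u) \<in> unit_rel"
      using c by (auto simp: unit_rel_def)
  qed
  show "trans (unit_rel :: (('n mod_ring ^ 2) \<times> _) set)"
  proof (rule transI)
    fix u v w :: "'n mod_ring ^ 2"
    assume "(u, v) \<in> unit_rel" "(v, w) \<in> unit_rel"
    then obtain c d where cd: "u \<in> nonzero_vecs" "w \<in> nonzero_vecs" "c dvd 1" "d dvd 1"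
      "u = c *s v" "v = d *s w"
      by (auto simp: unit_rel_def)
    have "c * d dvd 1"
      using mult_dvd_mono[OF cd(3,4)] by simp
    moreover have "u = (c * d) *s w"
      using cd by (simp add: vector_smult_assoc)
    ultimately show "(u, w) \<in> unit_rel"
      using cd by (auto simp: unit_rel_def)
  qed
qed

definition vec_class :: "'n::nontriv mod_ring ^ 2 \<Rightarrow> ('n mod_ring ^ 2) set" where
  "vec_class v = unit_rel `` {v}"

text \<open>
  Left multiplication on classes is defined as the image of the class; by \<open>class_act_vec_class\<close>
  below this is the class of the product.
\<close>

definition class_act :: "'n::nontriv mod_ring ^ 2 ^ 2 \<Rightarrow> ('n mod_ring ^ 2) set \<Rightarrow> ('n mod_ring ^ 2) set"
  where "class_act M C = (\<lambda>v. M *v v) ` C"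

lemma SL2_inverse:
  assumes "M \<in> SL2"
  obtains M' where "M' \<in> SL2" "M ** M' = mat 1" "M' ** M = mat 1"
proof -
  define M' where "M' = (vector [vector [M$2$2, - M$1$2], vector [- M$2$1, M$1$1]]
    :: 'a mod_ring ^ 2 ^ 2)"
  have d: "M$1$1 * M$2$2 - M$1$2 * M$2$1 = 1"
    using assms by (simp add: SL2_def det_2)
  then have "M' \<in> SL2"
    by (simp add: SL2_def det_2 M'_def mult.commute)
  moreover have "M ** M' = mat 1" "M' ** M = mat 1"
    using d by (simp_all add: vec_eq_iff forall_2 matrix_matrix_mult_def sum_2 M'_def mat_def
        algebra_simps)
  ultimately show thesis by (rule that)
qed

lemma SL2_nonzero_vecs:
  assumes "M \<in> SL2" "v \<in> nonzero_vecs"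
  shows "M *v v \<in> nonzero_vecs"
proof -
  obtain M' where "M' ** M = mat 1"
    using SL2_inverse[OF assms(1)] by blast
  then have "M' *v (M *v v) = v"
    by (simp add: matrix_vector_mul_assoc)
  then show ?thesis
    using assms(2) by (auto simp: nonzero_vecs_def)
qed

lemma unit_rel_mult:
  assumes "M \<in> SL2" "(u, v) \<in> unit_rel"
  shows "(M *v u, M *v v) \<in> unit_rel"
proof -
  have "M *v (c *s v) = c *s (M *v v)" for c
    by (simp add: vec_eq_iff matrix_vector_mult_def sum_distrib_left mult.left_commute)
  then show ?thesis
    using assms(2) SL2_nonzero_vecs[OF assms(1)] by (auto simp: unit_rel_def)
qed

lemma class_act_vec_class:
  assumes "M \<in> SL2"
  shows "class_act M (vec_class v) = vec_class (M *v v)"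
proof -
  obtain M' where M': "M' \<in> SL2" "M ** M' = mat 1" "M' ** M = mat 1"
    using SL2_inverse[OF assms] .
  have "u \<in> (\<lambda>v. M *v v) ` (unit_rel `` {v})" if "(M *v v, u) \<in> unit_rel" for u
  proof (rule image_eqI)
    show "u = M *v (M' *v u)"
      by (simp add: matrix_vector_mul_assoc M')
    show "M' *v u \<in> unit_rel `` {v}"
      using unit_rel_mult[OF M'(1) that] by (simp add: matrix_vector_mul_assoc M')
  qed
  then show ?thesis
    using unit_rel_mult[OF assms] by (auto simp: class_act_def vec_class_def)
qed

definition Abar :: "'n::nontriv word set" where
  "Abar = {w. class_act (word_mat w) (vec_class (vector [0, 1])) = vec_class (vector [1, 0])}"

definition Abar_len :: "nat \<Rightarrow> 'n::nontriv word set" where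
  "Abar_len l = {w. length w = l} \<inter> Abar"

definition immediate_successor :: "'n::nontriv word \<Rightarrow> 'n word \<Rightarrow> bool" where
  "immediate_successor w' w \<longleftrightarrow> (\<exists>\<alpha> v \<beta>. w = \<alpha> # v \<and> w' = v @ [\<beta>])"

definition immediate_predecessor :: "'n::nontriv word \<Rightarrow> 'n word \<Rightarrow> bool" where
  "immediate_predecessor w w' \<longleftrightarrow> immediate_successor w' w"

end

(*
  With M = word_mat w, membership of w in Abar says that the (2,2) entry of M vanishes: the other
  entry of the second column is then automatically a unit because det M = 1. For words a # v and
  v @ [b], with s the (2,2) entry of word_mat v, this condition is affine in the outer letter a or b
  with slope s; if either word lies in Abar, then det (word_mat v) = 1 forces s to be a unit, so the
  outer letter on the other side exists and is unique.
*)
theory Submission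
  imports Defs
begin

lemma Abar_iff: "w \<in> Abar \<longleftrightarrow> word_mat w $ 2 $ 2 = 0"
  for w :: "'n::nontriv word"
proof -
  define M where "M = word_mat w"
  define e1 e2 :: "'n mod_ring ^ 2" where "e1 = vector [1, 0]" and "e2 = vector [0, 1]"
  have M: "M \<in> SL2"
    by (simp add: M_def word_mat_in_SL2)
  have e: "e1 \<in> nonzero_vecs" "e2 \<in> nonzero_vecs"
    by (simp_all add: e1_def e2_def nonzero_vecs_def vec_eq_iff forall_2)
  have Me2: "(M *v e2) $ 1 = M $ 1 $ 2" "(M *v e2) $ 2 = M $ 2 $ 2"
    by (simp_all add: e2_def matrix_vector_mult_def sum_2)
  have "w \<in> Abar \<longleftrightarrow> vec_class (M *v e2) = vec_class e1"
    using class_act_vec_class[OF M, of e2] by (simp add: Abar_def M_def e1_def e2_def)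
  \<comment> \<open>Both vectors are nonzero, so they lie in the carrier of the equivalence
    relation.\<close>
  also have "\<dots> \<longleftrightarrow> (M *v e2, e1) \<in> unit_rel"
    unfolding vec_class_def
    using eq_equiv_class_iff[OF equiv_unit_rel SL2_nonzero_vecs[OF M e(2)] e(1)] .
  also have "\<dots> \<longleftrightarrow> (\<exists>c. c dvd 1 \<and> M *v e2 = c *s e1)"
    using SL2_nonzero_vecs[OF M e(2)] e(1) by (simp add: unit_rel_def)
  also have "\<dots> \<longleftrightarrow> M $ 1 $ 2 dvd 1 \<and> M $ 2 $ 2 = 0"
    \<comment> \<open>The first coordinate forces \<open>c = M $ 1 $ 2\<close>; the second forces
      \<open>M $ 2 $ 2 = 0\<close>.\<close>
    by (auto simp: vec_eq_iff[of "M *v e2"] forall_2 Me2 e1_def)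
  also have "\<dots> \<longleftrightarrow> M $ 2 $ 2 = 0"
  proof -
    have "M $ 1 $ 2 dvd 1" if "M $ 2 $ 2 = 0"
    proof
      show "1 = M $ 1 $ 2 * - M $ 2 $ 1"
        using M that by (simp add: SL2_def det_2)
    qed
    then show ?thesis by blast
  qed
  finally show ?thesis
    by (simp add: M_def)
qed

text \<open>The second row (-1, \<alpha>) of \<open>letter_mat \<alpha>\<close> meets the second
  column of \<open>word_mat v\<close>.\<close>

lemma Cons_in_Abar_iff:
  "\<alpha> # v \<in> Abar \<longleftrightarrow> - word_mat v $ 1 $ 2 + \<alpha> * word_mat v $ 2 $ 2 = 0"
  by (simp add: Abar_iff letter_mat_def matrix_matrix_mult_def sum_2)

text \<open>Here the second row of \<open>word_mat v\<close> meets the second column (1, \<beta>) of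
  \<open>letter_mat \<beta>\<close>.\<close>

lemma snoc_in_Abar_iff:
  "v @ [\<beta>] \<in> Abar \<longleftrightarrow> word_mat v $ 2 $ 1 + \<beta> * word_mat v $ 2 $ 2 = 0"
  by (simp add: Abar_iff word_mat_append letter_mat_def matrix_matrix_mult_def sum_2 mat_def
      mult.commute)

lemma det_word_mat:
  "word_mat v $ 1 $ 1 * word_mat v $ 2 $ 2 - word_mat v $ 1 $ 2 * word_mat v $ 2 $ 1 = 1"
  using word_mat_in_SL2[of v] by (simp add: SL2_def det_2)

lemma unit_if_Cons_in_Abar:
  assumes "\<alpha> # v \<in> Abar"
  shows "word_mat v $ 2 $ 2 dvd 1"
proof
  have "word_mat v $ 1 $ 2 = \<alpha> * word_mat v $ 2 $ 2"
    using assms by (simp add: Cons_in_Abar_iff)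
  \<comment> \<open>Substituting for the (1,2) entry makes the (2,2) entry a common factor of the
    determinant; the cofactor is its inverse.\<close>
  then show "1 = word_mat v $ 2 $ 2 * (word_mat v $ 1 $ 1 - \<alpha> * word_mat v $ 2 $ 1)"
    using det_word_mat[of v] by (simp add: algebra_simps)
qed

lemma unit_if_snoc_in_Abar:
  assumes "v @ [\<beta>] \<in> Abar"
  shows "word_mat v $ 2 $ 2 dvd 1"
proof
  have "word_mat v $ 2 $ 1 = - (\<beta> * word_mat v $ 2 $ 2)"
    using assms by (simp add: snoc_in_Abar_iff eq_neg_iff_add_eq_0)
  \<comment> \<open>The same factorization, now substituting for the (2,1) entry.\<close>
  then show "1 = word_mat v $ 2 $ 2 * (word_mat v $ 1 $ 1 + \<beta> * word_mat v $ 1 $ 2)"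
    using det_word_mat[of v] by (simp add: algebra_simps)
qed

text \<open>Multiplying by the inverse of \<open>s\<close> solves the equation and cancels the
  slope. With zero divisors around, as for composite N, a merely nonzero slope would not do.\<close>

lemma ex1_affine_root:
  fixes a s :: "'a::comm_ring_1"
  assumes "s dvd 1"
  shows "\<exists>!x. a + x * s = 0"
proof -
  obtain t where t: "1 = s * t"
    using assms by (elim dvdE)
  show ?thesis
  proof
    show "a + (- a * t) * s = 0"
      using t by (simp add: mult.assoc mult.commute[of t])
    show "x = - a * t" if "a + x * s = 0" for x
    proof -
      have "x = x * s * t"
        using t by (simp add: mult.assoc)
      also have "x * s = - a"
        using that by (simp add: eq_neg_iff_add_eq_0 add.commute)
      finally show ?thesis .
    qed
  qed
qed

theorem theorem5p3:
  fixes l :: nat and w :: "'n::nontriv mod_ring list"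
  assumes "l \<ge> 1"
    and "w \<in> Abar_len l"
  shows "(\<exists>!w'. w' \<in> Abar_len l \<and> immediate_successor w' w) \<and>
         (\<exists>!w'. w' \<in> Abar_len l \<and> immediate_predecessor w' w)"
proof
  have w: "length w = l" "w \<in> Abar" "w \<noteq> []"
    using assms by (auto simp: Abar_len_def)
  show "\<exists>!w'. w' \<in> Abar_len l \<and> immediate_successor w' w"
  proof -
    obtain \<alpha> v where v: "w = \<alpha> # v"
      using w(3) by (cases w) auto
    then have "\<exists>!\<beta>. v @ [\<beta>] \<in> Abar"
      using ex1_affine_root[OF unit_if_Cons_in_Abar[of \<alpha> v]] w(2) by (simp add: snoc_in_Abar_iff)
    \<comment> \<open>\<open>v @ [\<beta>]\<close> is as long as \<open>w\<close>, so the length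
      condition is automatic and successors correspond to letters \<beta>.\<close>
    moreover have "w' \<in> Abar_len l \<and> immediate_successor w' w \<longleftrightarrow>
        (\<exists>\<beta>. w' = v @ [\<beta>] \<and> v @ [\<beta>] \<in> Abar)" for w'
      using w(1) v by (auto simp: Abar_len_def immediate_successor_def)
    ultimately show ?thesis by auto
  qed
  show "\<exists>!w'. w' \<in> Abar_len l \<and> immediate_predecessor w' w"
  proof -
    \<comment> \<open>Now \<open>w\<close> is the later word of the pair: its last letter is split
      off and the first letter of the predecessor is the unknown.\<close>
    obtain v \<beta> where v: "w = v @ [\<beta>]"
      using w(3) by (cases w rule: rev_cases) auto
    then have "\<exists>!\<alpha>. \<alpha> # v \<in> Abar"
      using ex1_affine_root[OF unit_if_snoc_in_Abar[of v \<beta>], of "- word_mat v $ 1 $ 2"] w(2)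
      unfolding Cons_in_Abar_iff by simp
    moreover have "w' \<in> Abar_len l \<and> immediate_predecessor w' w \<longleftrightarrow>
        (\<exists>\<alpha>. w' = \<alpha> # v \<and> \<alpha> # v \<in> Abar)" for w'
      using w(1) v
      by (auto simp: Abar_len_def immediate_predecessor_def immediate_successor_def)
    ultimately show ?thesis by auto
  qed
qed

end
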